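(* Let $F\colon\mathbb{B}^{2L}\to\mathbb{B}^{2L}$ be the Boolean Delta-Notch system over a graph $\mathcal{G}$ as in the context, let $x\in\mathbb{B}^{2L}$ be a fixed point of $F$, and let $I=I_N\cup(I_D+L)$ with $I_N,I_D\subseteq C$. Then the subspace $x[I]$ is a trap space for $F$ if and only if all of the following hold: the subspace $x[I_N\cup(I_N+L)]$ is a trap space for $F$; $I_N\subseteq I_D$; (i) $S(I_D\setminus I_N)\cap I_D=\emptyset$ and $x_j=0$ for all $j\in I_D\setminus I_N$; and (ii) for every $i\in S(I_D\setminus I_N)$ there exists $j\in S(i)\cap(C\setminus I_D)$ such that $x_j=0$.
   Context: Let $L\ge 1$ and let $\mathcal{G}$ be an undirected connected graph without loops on the vertex set $C=\{1,\dots,L\}$. For $i\in C$ let $S(i)$ be the set of neighbours of $i$ in $\mathcal{G}$, and for $A\subseteq C$ let $S(A)=\bigcup_{i\in A}S(i)$; for $J\subseteq C$, $J+L=\{j+L: j\in J\}$. $\mathbb{B}=\{0,1\}$. States of $\mathbb{B}^{2L}$ are written $x=(n,d)=(n_1,\dots,n_L,d_1,\dots,d_L)$, so $x_i=n_i$ and $x_{i+L}=d_i$. The Boolean Delta-Notch system is $F\colon\mathbb{B}^{2L}\to\mathbb{B}^{2L}$ with $F_i(n,d)=\bigvee_{j\in S(i)}d_j$ (empty disjunction $=0$) and $F_{i+L}(n,d)=1-n_i$ for $i\in C$. The asynchronous dynamics $AD_F$ has an edge from $x$ to the state obtained by flipping coordinate $i$ whenever $F_i(x)\neq x_i$. For $I\subseteq\{1,\dots,2L\}$,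 the subspace $x[I]$ is $\{y: y_i=x_i \ \forall i\notin I\}$. A trap space is a subspace $A$ such that every successor in $AD_F$ of a state in $A$ lies in $A$. *)

theory Defs
  imports "HOL-Library.FuncSet" "Graph_Theory.Digraph_Component" "Graph_Theory.Pair_Digraph"
begin

text \<open>
  The Boolean values 0 and 1 are \<^const>\<open>False\<close> and \<^const>\<open>True\<close>. A state in $B^n$ is an extensional
  function on the coordinates \<open>1, ..., n\<close>, so states are equal iff they agree on these coordinates.
\<close>

definition bool_states :: "nat \<Rightarrow> (nat \<Rightarrow> bool) set" where
  "bool_states n = {1..n} \<rightarrow>\<^sub>E UNIV"

definition async_dynamics ::
    "nat \<Rightarrow> ((nat \<Rightarrow> bool) \<Rightarrow> nat \<Rightarrow> bool) \<Rightarrow> ((nat \<Rightarrow> bool) \<times> (nat \<Rightarrow> bool)) set" where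
  "async_dynamics n F =
     {(x, y). x \<in> bool_states n \<and> (\<exists>i\<in>{1..n}. F x i \<noteq> x i \<and> y = x(i := \<not> x i))}"

definition bool_subspace :: "nat \<Rightarrow> (nat \<Rightarrow> bool) \<Rightarrow> nat set \<Rightarrow> (nat \<Rightarrow> bool) set" where
  "bool_subspace n x I = {y \<in> bool_states n. \<forall>i\<in>{1..n} - I. y i = x i}"

definition trap_space ::
    "nat \<Rightarrow> ((nat \<Rightarrow> bool) \<Rightarrow> nat \<Rightarrow> bool) \<Rightarrow> (nat \<Rightarrow> bool) set \<Rightarrow> bool" where
  "trap_space n F A \<longleftrightarrow>
     (\<exists>x\<in>bool_states n. \<exists>I\<subseteq>{1..n}. A = bool_subspace n x I) \<and>
     (\<forall>x\<in>A. \<forall>y. (x, y) \<in> async_dynamics n F \<longrightarrow> y \<in> A)"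

text \<open>
  An undirected graph is a symmetric set of ordered pairs, so the out-neighbours of a vertex are
  its neighbours.
\<close>

definition nbrs :: "nat pair_pre_digraph \<Rightarrow> nat \<Rightarrow> nat set" where
  "nbrs G i = {j. (i, j) \<in> parcs G}"

definition nbrs_set :: "nat pair_pre_digraph \<Rightarrow> nat set \<Rightarrow> nat set" where
  "nbrs_set G A = (\<Union>i\<in>A. nbrs G i)"

definition shift :: "nat \<Rightarrow> nat set \<Rightarrow> nat set" where
  "shift L J = (\<lambda>j. j + L) ` J"

definition delta_notch ::
    "nat \<Rightarrow> nat pair_pre_digraph \<Rightarrow> (nat \<Rightarrow> bool) \<Rightarrow> nat \<Rightarrow> bool" where
  "delta_notch L G x =
     (\<lambda>k\<in>{1..2 * L}. if k \<le> L then (\<exists>j\<in>nbrs G k. x (j + L)) else \<not> x (k - L))"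

end

theory Submission
  imports Defs
begin

text \<open>
  At a fixed point the Delta value of a cell is the negation of its Notch value. Hence
  $x[I_N \cup (I_D + L)]$ is a trap space iff $I_N \subseteq I_D$ and every cell $i \notin I_N$
  with a neighbour in $I_D$ also has a neighbour $j \notin I_D$ with $x_j = 0$, whose constant
  Delta signal freezes the Notch value of $i$ at 1. If such a $j$ had itself a neighbour in $I_D$,
  the same criterion would give $x_j = 1$; this rules out neighbours in $I_D$ for cells of
  $I_D \setminus I_N$. The rest of the equivalence is set-theoretic bookkeeping.
\<close>

lemma bool_subspace_subset_states: "y \<in> bool_subspace n x I \<Longrightarrow> y \<in> bool_states n"
  by (simp add: bool_subspace_def)

lemma fun_upd_in_bool_states:
  "y \<in> bool_states n \<Longrightarrow> i \<in> {1..n} \<Longrightarrow> y(i := b) \<in> bool_states n"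
  unfolding bool_states_def by (auto simp: PiE_def extensional_def)

text \<open>A flip of a coordinate in \<open>I\<close> never leaves the subspace, and a flip of any
  other coordinate always does. So the trap property says exactly that no flip outside
  \<open>I\<close> is ever enabled, and there \<open>y i\<close> equals \<open>x i\<close>.\<close>

lemma trap_space_subspace_iff:
  assumes "x \<in> bool_states n" "I \<subseteq> {1..n}"
  shows "trap_space n F (bool_subspace n x I) \<longleftrightarrow>
    (\<forall>y\<in>bool_subspace n x I. \<forall>i\<in>{1..n} - I. F y i = x i)" (is "?trap \<longleftrightarrow> ?frozen")
proof
  assume trap: ?trap
  show ?frozen
  proof (intro ballI, rule ccontr)
    fix y i assume y: "y \<in> bool_subspace n x I" and i: "i \<in> {1..n} - I" and ne: "F y i \<noteq> x i"
    from y i have yi: "y i = x i" by (auto simp: bool_subspace_def)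
    with y i ne have "(y, y(i := \<not> y i)) \<in> async_dynamics n F"
      by (auto simp: async_dynamics_def bool_subspace_def intro!: bexI[of _ i])
    with trap y have "y(i := \<not> y i) \<in> bool_subspace n x I"
      unfolding trap_space_def by blast
    then have "(y(i := \<not> y i)) i = x i"
      using i unfolding bool_subspace_def by blast
    with yi show False by simp
  qed
next
  assume frozen: ?frozen
  have "z \<in> bool_subspace n x I"
    if y: "y \<in> bool_subspace n x I" and step: "(y, z) \<in> async_dynamics n F" for y z
  proof -
    from step obtain i where i: "i \<in> {1..n}" "F y i \<noteq> y i" and z: "z = y(i := \<not> y i)"
      unfolding async_dynamics_def by blast
    have "i \<in> I"
    proof (rule ccontr)
      assume "i \<notin> I"
      with i y have "y i = x i" by (auto simp: bool_subspace_def)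
      with frozen y i \<open>i \<notin> I\<close> show False by auto
    qed
    moreover have "z \<in> bool_states n"
      using y i(1) z by (simp add: bool_subspace_subset_states fun_upd_in_bool_states)
    ultimately show ?thesis
      using y z by (auto simp: bool_subspace_def)
  qed
  with assms show ?trap
    unfolding trap_space_def by blast
qed

lemma fixed_point_delta:
  assumes "delta_notch L G x = x" "j \<in> {1..L}"
  shows "x (j + L) \<longleftrightarrow> \<not> x j"
proof -
  have "delta_notch L G x (j + L) \<longleftrightarrow> \<not> x j"
    using assms(2) by (auto simp: delta_notch_def)
  with assms(1) show ?thesis by simp
qed

text \<open>Eliminates the Delta values. On an undirected graph it says that the cells with Notch
  value 0 form a maximal independent set.\<close>

lemma fixed_point_notch:
  assumes "delta_notch L G x = x" "i \<in> {1..L}" "nbrs G i \<subseteq> {1..L}"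
  shows "x i \<longleftrightarrow> (\<exists>j\<in>nbrs G i. \<not> x j)"
proof -
  have "delta_notch L G x i \<longleftrightarrow> (\<exists>j\<in>nbrs G i. x (j + L))"
    using assms(2) by (auto simp: delta_notch_def)
  also have "\<dots> \<longleftrightarrow> (\<exists>j\<in>nbrs G i. \<not> x j)"
    using fixed_point_delta[OF assms(1)] assms(3) by blast
  finally show ?thesis using assms(1) by simp
qed

lemma mem_shift_iff [simp]: "j + L \<in> shift L J \<longleftrightarrow> j \<in> J"
  by (auto simp: shift_def)

text \<open>A fixed Delta coordinate negates its own Notch value, which must then be fixed too. A
  fixed Notch coordinate is a disjunction of Delta values, constant iff no input is free or some
  fixed input is 1.\<close>

lemma delta_notch_trap_space_iff:
  assumes x: "x \<in> bool_states (2 * L)" and fixed: "delta_notch L G x = x"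
    and nbrs: "\<And>i. nbrs G i \<subseteq> {1..L}"
    and IN: "I\<^sub>N \<subseteq> {1..L}" and ID: "I\<^sub>D \<subseteq> {1..L}"
  shows "trap_space (2 * L) (delta_notch L G) (bool_subspace (2 * L) x (I\<^sub>N \<union> shift L I\<^sub>D)) \<longleftrightarrow>
    I\<^sub>N \<subseteq> I\<^sub>D \<and>
    (\<forall>i\<in>{1..L} - I\<^sub>N. nbrs G i \<inter> I\<^sub>D \<noteq> {} \<longrightarrow> (\<exists>j\<in>nbrs G i - I\<^sub>D. \<not> x j))"
    (is "?trap \<longleftrightarrow> ?crit")
proof -
  define I where "I = I\<^sub>N \<union> shift L I\<^sub>D"
  have I: "I \<subseteq> {1..2 * L}"
    using IN ID by (auto simp: I_def shift_def)
  \<comment> \<open>Cells are numbered from 1, so Notch indices are at most \<open>L\<close> and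
    Delta indices exceed \<open>L\<close>: the two parts of \<open>I\<close> cannot
    interfere.\<close>
  have low: "i \<in> I \<longleftrightarrow> i \<in> I\<^sub>N" if "i \<in> {1..L}" for i
    using that ID by (auto simp: I_def shift_def)
  have high: "i + L \<in> I \<longleftrightarrow> i \<in> I\<^sub>D" if "i \<in> {1..L}" for i
    using that IN by (auto simp: I_def)
  have trap_iff: "?trap \<longleftrightarrow>
      (\<forall>y\<in>bool_subspace (2 * L) x I. \<forall>i\<in>{1..2 * L} - I. delta_notch L G y i = x i)"
    using trap_space_subspace_iff[OF x I] by (simp add: I_def)
  have notch: "delta_notch L G y i \<longleftrightarrow> (\<exists>j\<in>nbrs G i. y (j + L))" if "i \<in> {1..L}" for y i
    using that by (auto simp: delta_notch_def)
  have delta: "delta_notch L G y (i + L) \<longleftrightarrow> \<not> y i" if "i \<in> {1..L}" for y i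
    using that by (auto simp: delta_notch_def)
  show ?thesis
  proof
    assume ?trap
    then have frozen: "delta_notch L G y i = x i"
      if "y \<in> bool_subspace (2 * L) x I" "i \<in> {1..2 * L}" "i \<notin> I" for y i
      using that trap_iff by blast
    \<comment> \<open>The two extreme states of the subspace: every free coordinate is set to
      \<open>b\<close>. They suffice to detect a value that is not frozen.\<close>
    define y where "y b = (\<lambda>k. if k \<in> I then b else x k)" for b
    have y: "y b \<in> bool_subspace (2 * L) x I" for b
      using x I unfolding y_def bool_subspace_def bool_states_def
      by (auto simp: PiE_def extensional_def)
    have "I\<^sub>N \<subseteq> I\<^sub>D"
    proof (rule ccontr)
      assume "\<not> I\<^sub>N \<subseteq> I\<^sub>D"
      then obtain i where i: "i \<in> I\<^sub>N" "i \<notin> I\<^sub>D" by blast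
      with IN have iL: "i \<in> {1..L}" by blast
      have "(\<not> y b i) = x (i + L)" for b
        using frozen[OF y, of "i + L" b] delta[OF iL] high[OF iL] i iL by auto
      from this[of True] this[of False] show False
        using i low[OF iL] by (simp add: y_def)
    qed
    moreover have "\<exists>j\<in>nbrs G i - I\<^sub>D. \<not> x j"
      if i: "i \<in> {1..L} - I\<^sub>N" and meets: "nbrs G i \<inter> I\<^sub>D \<noteq> {}" for i
    proof -
      have iL: "i \<in> {1..L}" using i by blast
      have notch_y: "(\<exists>j\<in>nbrs G i. y b (j + L)) \<longleftrightarrow> x i" for b
        using frozen[OF y, of i b] notch[OF iL] low[OF iL] i by auto
      from meets obtain k where k: "k \<in> nbrs G i" "k \<in> I\<^sub>D" by blast
      with ID high have "y True (k + L)" by (auto simp: y_def)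
      with k notch_y[of True] have "x i" by blast
      with notch_y[of False] obtain j where j: "j \<in> nbrs G i" "y False (j + L)" by blast
      with nbrs have jL: "j \<in> {1..L}" by blast
      from j(2) have "j + L \<notin> I" "x (j + L)" by (auto simp: y_def split: if_splits)
      with j(1) high[OF jL] fixed_point_delta[OF fixed jL] show ?thesis by blast
    qed
    ultimately show ?crit by blast
  next
    assume crit: ?crit
    show ?trap
      unfolding trap_iff
    proof (intro ballI)
      fix y k assume y: "y \<in> bool_subspace (2 * L) x I" and k: "k \<in> {1..2 * L} - I"
      have eq: "y m = x m" if "m \<in> {1..2 * L}" "m \<notin> I" for m
        using y that by (auto simp: bool_subspace_def)
      show "delta_notch L G y k = x k"
      proof (cases "k \<le> L")
        case True
        with k low have kL: "k \<in> {1..L}" and kN: "k \<in> {1..L} - I\<^sub>N" by auto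
        have out: "y (j + L) = x (j + L)" if "j \<in> nbrs G k" "j \<notin> I\<^sub>D" for j
        proof -
          have jL: "j \<in> {1..L}" using nbrs that by blast
          then show ?thesis using high[OF jL] that eq[of "j + L"] by auto
        qed
        show ?thesis
        proof (cases "nbrs G k \<inter> I\<^sub>D = {}")
          case True
          then have "delta_notch L G y k = delta_notch L G x k"
            unfolding notch[OF kL] using out by blast
          with fixed show ?thesis by simp
        next
          case False
          with crit kN obtain j where j: "j \<in> nbrs G k" "j \<notin> I\<^sub>D" "\<not> x j" by blast
          with nbrs have "x (j + L)" using fixed_point_delta[OF fixed] by blast
          with j out have "delta_notch L G y k" unfolding notch[OF kL] by blast
          moreover have "x k" using fixed_point_notch[OF fixed kL nbrs] j by blast
          ultimately show ?thesis by simp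
        qed
      next
        case False
        define i where "i = k - L"
        with False k have ki: "k = i + L" and iL: "i \<in> {1..L}" by auto
        \<comment> \<open>This is where the inclusion enters: \<open>i\<close> is not in
          \<open>I\<^sub>D\<close>, hence not in \<open>I\<^sub>N\<close>.\<close>
        with k high crit low have "i \<notin> I" by blast
        with eq[of i] iL have "y i = x i" by auto
        then show ?thesis
          using delta[OF iL] fixed_point_delta[OF fixed iL] ki by auto
      qed
    qed
  qed
qed

theorem theorem8:
  fixes L :: nat
    and G :: "nat pair_pre_digraph"
    and x :: "nat \<Rightarrow> bool"
    and I\<^sub>N I\<^sub>D :: "nat set"
  assumes "L \<ge> 1"
    and "pair_graph G"
    and "pverts G = {1..L}"
    and "Digraph_Component.connected (with_proj G)"
    and "x \<in> bool_states (2 * L)"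
    and "delta_notch L G x = x"
    and "I\<^sub>N \<subseteq> {1..L}"
    and "I\<^sub>D \<subseteq> {1..L}"
  shows "trap_space (2 * L) (delta_notch L G) (bool_subspace (2 * L) x (I\<^sub>N \<union> shift L I\<^sub>D)) \<longleftrightarrow>
     trap_space (2 * L) (delta_notch L G) (bool_subspace (2 * L) x (I\<^sub>N \<union> shift L I\<^sub>N)) \<and>
     I\<^sub>N \<subseteq> I\<^sub>D \<and>
     (nbrs_set G (I\<^sub>D - I\<^sub>N) \<inter> I\<^sub>D = {} \<and> (\<forall>j\<in>I\<^sub>D - I\<^sub>N. x j = False)) \<and>
     (\<forall>i\<in>nbrs_set G (I\<^sub>D - I\<^sub>N). \<exists>j\<in>nbrs G i \<inter> ({1..L} - I\<^sub>D). x j = False)"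
proof -
  interpret pair_graph G by fact
  have nbrs_subset: "nbrs G i \<subseteq> {1..L}" for i
    unfolding nbrs_def assms(3)[symmetric] by (blast dest: in_arcsD2)
  have nbrs_sym: "j \<in> nbrs G i" if "i \<in> nbrs G j" for i j
    using that arcs_symmetric unfolding nbrs_def by blast
  note iff = delta_notch_trap_space_iff[OF assms(5,6) nbrs_subset assms(7)]
  note notch = fixed_point_notch[OF assms(6) _ nbrs_subset]
  let ?crit = "\<lambda>J. \<forall>i\<in>{1..L} - I\<^sub>N. nbrs G i \<inter> J \<noteq> {} \<longrightarrow> (\<exists>j\<in>nbrs G i - J. \<not> x j)"
  let ?trapN = "trap_space (2 * L) (delta_notch L G) (bool_subspace (2 * L) x (I\<^sub>N \<union> shift L I\<^sub>N))"
  have trapN_iff: "?trapN \<longleftrightarrow> ?crit I\<^sub>N"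
    unfolding iff[OF assms(7)] by (simp only: order_refl simp_thms)
  show ?thesis (is "?trapD \<longleftrightarrow> ?rhs")
  proof
    assume ?trapD
    then have sub: "I\<^sub>N \<subseteq> I\<^sub>D" and crit: "?crit I\<^sub>D"
      unfolding iff[OF assms(8)] by simp_all
    have outside: "x i" if "i \<in> {1..L} - I\<^sub>N" "j \<in> nbrs G i" "j \<in> I\<^sub>D" for i j
      using crit notch that by blast
    have disjoint: "i \<notin> I\<^sub>D" if j: "j \<in> I\<^sub>D - I\<^sub>N" and i: "i \<in> nbrs G j" for i j
    proof
      assume "i \<in> I\<^sub>D"
      \<comment> \<open>Apply the criterion at \<open>j\<close>, which has the neighbour
        \<open>i\<close> in \<open>I\<^sub>D\<close>. Its witness \<open>k\<close> is adjacent to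
        \<open>j\<close> in \<open>I\<^sub>D\<close>, so \<open>outside\<close> makes
        \<open>x k\<close> true, a contradiction.\<close>
      with crit i j assms(8) obtain k where k: "k \<in> nbrs G j" "k \<notin> I\<^sub>D" "\<not> x k" by blast
      moreover have "k \<in> {1..L} - I\<^sub>N" using k nbrs_subset sub by blast
      ultimately show False using outside[of k j] nbrs_sym j by blast
    qed
    have zero: "\<not> x j" if j: "j \<in> I\<^sub>D - I\<^sub>N" for j
    proof
      assume "x j"
      \<comment> \<open>A Notch value 1 at \<open>j\<close> needs a neighbour \<open>k\<close> with
        value 0. By \<open>disjoint\<close>, \<open>k\<close> lies outside \<open>I\<^sub>D\<close>,
        and its neighbour \<open>j\<close> again forces \<open>x k\<close>.\<close>
      with notch j assms(8) obtain k where k: "k \<in> nbrs G j" "\<not> x k" by blast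
      with disjoint[OF j] nbrs_subset sub have "k \<in> {1..L} - I\<^sub>N" by blast
      with k j nbrs_sym outside[of k j] show False by blast
    qed
    have "\<exists>j\<in>nbrs G i \<inter> ({1..L} - I\<^sub>D). \<not> x j"
      if j: "j \<in> I\<^sub>D - I\<^sub>N" and i: "i \<in> nbrs G j" for i j
    proof -
      have "i \<in> {1..L} - I\<^sub>N" using disjoint[OF j i] nbrs_subset i sub by blast
      moreover have "nbrs G i \<inter> I\<^sub>D \<noteq> {}" using nbrs_sym[OF i] j by blast
      ultimately obtain l where "l \<in> nbrs G i - I\<^sub>D" "\<not> x l" using crit by blast
      then show ?thesis using nbrs_subset by blast
    qed
    then have "\<forall>i\<in>nbrs_set G (I\<^sub>D - I\<^sub>N). \<exists>j\<in>nbrs G i \<inter> ({1..L} - I\<^sub>D). x j = False"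
      unfolding nbrs_set_def by simp
    \<comment> \<open>Shrinking \<open>I\<^sub>D\<close> to \<open>I\<^sub>N\<close> weakens the
      criterion: fewer cells need a witness, and the old witnesses still avoid the smaller
      set.\<close>
    moreover have ?trapN unfolding trapN_iff using crit sub by blast
    moreover have "nbrs_set G (I\<^sub>D - I\<^sub>N) \<inter> I\<^sub>D = {}"
      unfolding nbrs_set_def using disjoint by blast
    ultimately show ?rhs
      using sub zero by simp
  next
    assume rhs: ?rhs
    then have critN: "?crit I\<^sub>N" using trapN_iff by simp
    from rhs have signal:
      "\<forall>i\<in>nbrs_set G (I\<^sub>D - I\<^sub>N). \<exists>j\<in>nbrs G i \<inter> ({1..L} - I\<^sub>D). \<not> x j" by simp
    have "\<exists>j\<in>nbrs G i - I\<^sub>D. \<not> x j"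
      if i: "i \<in> {1..L} - I\<^sub>N" and meets: "nbrs G i \<inter> I\<^sub>D \<noteq> {}" for i
    \<comment> \<open>If all neighbours of \<open>i\<close> in \<open>I\<^sub>D\<close> are in
      \<open>I\<^sub>N\<close>, a witness outside \<open>I\<^sub>N\<close> is also outside
      \<open>I\<^sub>D\<close>. Otherwise \<open>i\<close> is adjacent to a cell of
      \<open>I\<^sub>D - I\<^sub>N\<close>, and condition (ii) supplies the witness.\<close>
    proof (cases "nbrs G i \<inter> I\<^sub>D \<subseteq> I\<^sub>N")
      case True
      with i meets critN obtain j where "j \<in> nbrs G i - I\<^sub>N" "\<not> x j" by blast
      with True show ?thesis by blast
    next
      case False
      then have "i \<in> nbrs_set G (I\<^sub>D - I\<^sub>N)"
        using nbrs_sym unfolding nbrs_set_def by blast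
      with signal show ?thesis by blast
    qed
    with rhs show ?trapD unfolding iff[OF assms(8)] by simp
  qed
qed

end
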